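(* Let $1\le p\le\infty$, let $X,Y$ be $p$-multinormed spaces, let $n\in\mathbb{N}$, and let $T:X\to Y$ be a bounded linear operator of rank $n$. Fix $\varepsilon\in(0,1)$ and let $M=2^n\lceil 4n^3/\varepsilon\rceil^n$. Then $$\|T\|_p\le(1+\varepsilon)\,\big\|I_{\ell^p_M}\otimes T:\ell^p_M\otimes X\to\ell^p_M\otimes Y\big\|.$$
   Context: All spaces are over the real field; $\mathbb{N}=\{1,2,\dots\}$. For $1\le p\le\infty$, a $p$-multinormed space is a Banach space $X$ together with, for each $n\in\mathbb{N}$, a norm $\|\cdot\|_n$ (written $\|\cdot\|$) on $\ell^p_n\otimes X$ such that: (1) $\|a\otimes x\|_n=\|a\|\,\|x\|$ for $a\in\ell^p_n$, $x\in X$; (2) $\|w\|_n\ge|\langle a^*\otimes x^*,w\rangle|$ for all $w\in\ell^p_n\otimes X$ and all $a^*\in(\ell^p_n)^*$, $x^*\in X^*$ of norm at most $1$; (3) $\|(T\otimes I_X)w\|_m\le\|T\|\,\|w\|_n$ for all $m,n$, all $T\in B(\ell^p_n,\ell^p_m)$ and all $w\in\ell^p_n\otimes X$. (This is equivalent to giving a left tensorial cross-norm on $\ell^p\otimes X$, or on $c_0\otimes X$ if $p=\infty$.) For a linear map $u:X\to Y$ between $p$-multinormed spaces, $\|u\|_p=\sup_n\|I_{\ell^p_n}\otimes u:\ell^p_n\otimes X\to\ell^p_n\otimes Y\|$. *)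

theory Defs
  imports "HOL-Analysis.Analysis"
begin

text \<open>
  The algebraic tensor product of the n-dimensional space of scalar n-tuples with X is modelled
  by its coordinate form X^n: the sum of e_i tensor w_i (i < n) is the function i |-> w_i, and
  tuples are functions on the naturals that vanish from index n on. For X = R this is the space
  of scalar n-tuples itself.
\<close>

definition tuples :: "nat \<Rightarrow> (nat \<Rightarrow> 'a::real_vector) set" where
  "tuples n = {w. \<forall>i\<ge>n. w i = 0}"

definition lp_norm :: "ereal \<Rightarrow> nat \<Rightarrow> (nat \<Rightarrow> real) \<Rightarrow> real" where
  "lp_norm p n a =
    (if p = \<infinity> then Max ((\<lambda>i. \<bar>a i\<bar>) ` {..<n})
     else (\<Sum>i<n. \<bar>a i\<bar> powr real_of_ereal p) powr (1 / real_of_ereal p))"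

definition lp_ball :: "ereal \<Rightarrow> nat \<Rightarrow> (nat \<Rightarrow> real) set" where
  "lp_ball p n = {a \<in> tuples n. lp_norm p n a \<le> 1}"

text \<open>
  Functionals on scalar n-tuples are given by their coefficients b, and operators from n-tuples
  to m-tuples by their matrices t (row index first); both act on X-valued tuples as well.
  The two norms below are suprema of bounded nonempty sets of reals when n, m and p are at
  least 1.
\<close>

definition pairing :: "nat \<Rightarrow> (nat \<Rightarrow> real) \<Rightarrow> (nat \<Rightarrow> 'a::real_vector) \<Rightarrow> 'a" where
  "pairing n b w = (\<Sum>i<n. b i *\<^sub>R w i)"

definition apply_matrix ::
    "nat \<Rightarrow> nat \<Rightarrow> (nat \<Rightarrow> nat \<Rightarrow> real) \<Rightarrow> (nat \<Rightarrow> 'a::real_vector) \<Rightarrow> (nat \<Rightarrow> 'a)" where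
  "apply_matrix m n t w = (\<lambda>j. if j < m then pairing n (t j) w else 0)"

definition lp_dual_norm :: "ereal \<Rightarrow> nat \<Rightarrow> (nat \<Rightarrow> real) \<Rightarrow> real" where
  "lp_dual_norm p n b = (SUP a\<in>lp_ball p n. \<bar>pairing n b a\<bar>)"

definition lp_op_norm :: "ereal \<Rightarrow> nat \<Rightarrow> nat \<Rightarrow> (nat \<Rightarrow> nat \<Rightarrow> real) \<Rightarrow> real" where
  "lp_op_norm p m n t = (SUP a\<in>lp_ball p n. lp_norm p m (apply_matrix m n t a))"

definition tensor :: "(nat \<Rightarrow> real) \<Rightarrow> 'a::real_vector \<Rightarrow> (nat \<Rightarrow> 'a)" where
  "tensor a x = (\<lambda>i. a i *\<^sub>R x)"

definition amplify :: "('a \<Rightarrow> 'b) \<Rightarrow> (nat \<Rightarrow> 'a) \<Rightarrow> (nat \<Rightarrow> 'b)" where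
  "amplify u w = (\<lambda>i. u (w i))"

definition is_norm_on_tuples :: "nat \<Rightarrow> ((nat \<Rightarrow> 'a::real_vector) \<Rightarrow> real) \<Rightarrow> bool" where
  "is_norm_on_tuples n N \<longleftrightarrow>
    (\<forall>w\<in>tuples n. 0 \<le> N w \<and> (N w = 0 \<longleftrightarrow> w = (\<lambda>_. 0))) \<and>
    (\<forall>w\<in>tuples n. \<forall>c. N (\<lambda>i. c *\<^sub>R w i) = \<bar>c\<bar> * N w) \<and>
    (\<forall>v\<in>tuples n. \<forall>w\<in>tuples n. N (\<lambda>i. v i + w i) \<le> N v + N w)"

text \<open>
  Only the values of \<open>N n\<close> on \<open>tuples n\<close> for positive n are constrained (and used below).
\<close>

locale multinormed =
  fixes p :: ereal
    and N :: "nat \<Rightarrow> (nat \<Rightarrow> 'a::banach) \<Rightarrow> real"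
  assumes norm: "n \<ge> 1 \<Longrightarrow> is_norm_on_tuples n (N n)"
    and cross: "n \<ge> 1 \<Longrightarrow> a \<in> tuples n \<Longrightarrow> N n (tensor a x) = lp_norm p n a * norm x"
    and dual: "n \<ge> 1 \<Longrightarrow> w \<in> tuples n \<Longrightarrow> b \<in> tuples n \<Longrightarrow> lp_dual_norm p n b \<le> 1 \<Longrightarrow>
      norm (x' :: 'a \<Rightarrow>\<^sub>L real) \<le> 1 \<Longrightarrow>
      \<bar>pairing n b (amplify (blinfun_apply x') w)\<bar> \<le> N n w"
    and left: "n \<ge> 1 \<Longrightarrow> m \<ge> 1 \<Longrightarrow> w \<in> tuples n \<Longrightarrow>
      N m (apply_matrix m n t w) \<le> lp_op_norm p m n t * N n w"

text \<open>
  Operator norm of the n-th amplification of u, and the supremum over all n; extended-valued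
  because the supremum may be infinite.
\<close>

definition amp_norm ::
    "(nat \<Rightarrow> (nat \<Rightarrow> 'a::banach) \<Rightarrow> real) \<Rightarrow> (nat \<Rightarrow> (nat \<Rightarrow> 'b::banach) \<Rightarrow> real)
      \<Rightarrow> nat \<Rightarrow> ('a \<Rightarrow> 'b) \<Rightarrow> ennreal" where
  "amp_norm NX NY n u = (SUP w\<in>{w \<in> tuples n. NX n w \<le> 1}. ennreal (NY n (amplify u w)))"

definition multi_norm ::
    "(nat \<Rightarrow> (nat \<Rightarrow> 'a::banach) \<Rightarrow> real) \<Rightarrow> (nat \<Rightarrow> (nat \<Rightarrow> 'b::banach) \<Rightarrow> real)
      \<Rightarrow> ('a \<Rightarrow> 'b) \<Rightarrow> ennreal" where
  "multi_norm NX NY u = (SUP n\<in>{1..}. amp_norm NX NY n u)"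

lemma tuples_eq_sum_tensor:
  assumes "w \<in> tuples n"
  shows "w j = (\<Sum>i<n. tensor (\<lambda>k. if k = i then 1 else 0) (w i) j)"
proof -
  have "(\<Sum>i<n. tensor (\<lambda>k. if k = i then 1 else 0) (w i) j) = (\<Sum>i<n. if j = i then w i else 0)"
    by (rule sum.cong) (auto simp: tensor_def)
  also have "\<dots> = w j"
    using assms by (auto simp: tuples_def)
  finally show ?thesis by simp
qed

lemma apply_matrix_tensor:
  "apply_matrix m n t (tensor a x) = tensor (apply_matrix m n t a) x"
  by (auto simp: apply_matrix_def pairing_def tensor_def scaleR_sum_left)

lemma pairing_tensor:
  "linear f \<Longrightarrow> pairing n b (amplify f (tensor a x)) = pairing n b a * f x"
  by (simp add: pairing_def amplify_def tensor_def linear_scale sum_distrib_right mult.assoc)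

lemma amplify_tensor:
  "linear u \<Longrightarrow> amplify u (tensor a x) = tensor a (u x)"
  by (simp add: amplify_def tensor_def linear_scale)

end

(* Write T w = sum_j F_j (x) e_j on a nearly Auerbach basis (e_j) of the range of T. Grouping the
   coordinates of w by the direction of (F_1, ..., F_n), rounded on a grid with M cells, replaces
   every F_j by a multiple, on each group, of one common weight. The normalized weights span an
   isometric copy of the M-dimensional space, complemented by a contraction; on this copy the
   M-th amplification of T controls T w, and the rounding costs at most epsilon times its norm. *)

theory Submission
  imports Defs "Jordan_Normal_Form.Determinant"
begin

subsection \<open>Finite-dimensional l^p norms\<close>

text \<open>There is no hope of approximating \<open>w\<close> itself by finitely many directions,
  since X may be infinite-dimensional; finite rank helps only for T w. So the projection is never
  compared with the identity on X-valued tuples. It is given by scalar matrices, hence commutes with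
  T, and axiom \<open>left\<close> makes both of its factors contractions on vector-valued tuples;
  the projected part of T w is therefore bounded by the M-th amplification with constant 1, however
  far the projection moves \<open>w\<close>. What remains is the rounding error, which must be
  bounded independently of the number of coordinates of \<open>w\<close>. This is why directions are
  rounded rather than values: at each coordinate the error is at most 1/K times the weight there, so
  its norm is at most 1/K times the norm of the weight. With 2K grid values for each of the n
  quotients there are (2K)^n = M cells.\<close>

lemma zero_tuples: "(\<lambda>_. 0) \<in> tuples n"
  by (simp add: tuples_def)

lemma apply_matrix_in_tuples: "apply_matrix m n t w \<in> tuples m"
  by (simp add: apply_matrix_def tuples_def)

lemma apply_matrix_diff:
  "apply_matrix m n t (\<lambda>i. v i - w i) = (\<lambda>j. apply_matrix m n t v j - apply_matrix m n t w j)"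
  by (auto simp: apply_matrix_def pairing_def scaleR_diff_right sum_subtractf)

lemma apply_matrix_sum:
  "apply_matrix m n t (\<lambda>i. \<Sum>j\<in>J. v j i) = (\<lambda>i. \<Sum>j\<in>J. apply_matrix m n t (v j) i)"
  by (rule ext) (simp add: apply_matrix_def pairing_def scaleR_sum_right sum.swap[of _ J])

lemma amplify_apply_matrix:
  assumes "linear u"
  shows "amplify u (apply_matrix m n t w) = apply_matrix m n t (amplify u w)"
  using assms
  by (auto simp: amplify_def apply_matrix_def pairing_def linear_sum linear_scale linear_0)

lemma amplify_in_tuples: "linear u \<Longrightarrow> w \<in> tuples n \<Longrightarrow> amplify u w \<in> tuples n"
  by (simp add: tuples_def amplify_def linear_0)

lemma tensor_in_tuples: "a \<in> tuples n \<Longrightarrow> tensor a x \<in> tuples n"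
  by (simp add: tuples_def tensor_def)

lemma lp_norm_infinity: "lp_norm \<infinity> n a = Max ((\<lambda>i. \<bar>a i\<bar>) ` {..<n})"
  by (simp add: lp_norm_def)

lemma lp_norm_ereal: "lp_norm (ereal r) n a = (\<Sum>i<n. \<bar>a i\<bar> powr r) powr (1 / r)"
  by (simp add: lp_norm_def)

lemma exponent_cases:
  fixes p :: ereal
  assumes "1 \<le> p"
  obtains (infinite) "p = \<infinity>" | (real) r where "p = ereal r" "1 \<le> r"
  using assms by (cases p) auto

text \<open>Young's inequality for x^r and y^r with weights 1 - 1/r and 1/r. Avoiding the conjugate
  exponent lets r = 1 be treated together with r > 1.\<close>

lemma Young_powr:
  fixes x y r :: real
  assumes "1 \<le> r" "0 < x" "0 \<le> y"
  shows "x powr (r - 1) * y \<le> (1 - 1 / r) * x powr r + y powr r / r"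
proof (cases "y = 0")
  case True
  then show ?thesis using assms by simp
next
  case False
  then show ?thesis
    using Youngs_inequality_0[of "1 - 1 / r" "1 / r" "x powr r" "y powr r"] assms
    by (simp add: powr_powr algebra_simps)
qed

definition block :: "(nat \<Rightarrow> nat) \<Rightarrow> nat \<Rightarrow> (nat \<Rightarrow> real) \<Rightarrow> nat \<Rightarrow> real" where
  "block c k a = (\<lambda>i. if c i = k then a i else 0)"

context
  fixes p :: ereal
  assumes p: "1 \<le> p"
begin

lemma lp_norm_cong: "(\<And>i. i < m \<Longrightarrow> a i = b i) \<Longrightarrow> lp_norm p m a = lp_norm p m b"
  unfolding lp_norm_def by (intro if_cong arg_cong[where f = Max] image_cong) auto

lemma lp_norm_mono:
  assumes "m \<ge> 1" "\<And>i. i < m \<Longrightarrow> \<bar>a i\<bar> \<le> \<bar>b i\<bar>"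
  shows "lp_norm p m a \<le> lp_norm p m b"
  using p
proof (cases rule: exponent_cases)
  case infinite
  have "\<bar>a i\<bar> \<le> Max ((\<lambda>i. \<bar>b i\<bar>) ` {..<m})" if "i < m" for i
    using assms(2)[OF that] that by (intro order_trans[OF _ Max_ge]) auto
  then show ?thesis
    using assms(1) by (auto simp: infinite lp_norm_infinity Max_le_iff lessThan_empty_iff)
next
  case (real r)
  then show ?thesis
    by (auto simp: lp_norm_ereal intro!: powr_mono2 sum_mono sum_nonneg assms(2))
qed

lemma lp_norm_scale:
  assumes "m \<ge> 1"
  shows "lp_norm p m (\<lambda>i. c * a i) = \<bar>c\<bar> * lp_norm p m a"
  using p
proof (cases rule: exponent_cases)
  case infinite
  have "Max ((\<lambda>x. \<bar>c\<bar> * x) ` (\<lambda>i. \<bar>a i\<bar>) ` {..<m}) = \<bar>c\<bar> * Max ((\<lambda>i. \<bar>a i\<bar>) ` {..<m})"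
    using assms
    by (intro mono_Max_commute[symmetric]) (auto simp: mono_def mult_left_mono lessThan_empty_iff)
  then show ?thesis
    by (simp add: infinite lp_norm_infinity image_image abs_mult)
next
  case (real r)
  then show ?thesis
    by (simp add: lp_norm_ereal abs_mult powr_mult sum_nonneg powr_powr flip: sum_distrib_left)
qed

lemma lp_norm_single:
  assumes "k < m"
  shows "lp_norm p m (\<lambda>i. if i = k then c else 0) = \<bar>c\<bar>"
  using p
proof (cases rule: exponent_cases)
  case infinite
  then show ?thesis using assms by (auto simp: lp_norm_infinity intro!: Max_eqI)
next
  case (real r)
  have "(\<Sum>i<m. \<bar>if i = k then c else 0\<bar> powr r) = (\<Sum>i<m. if i = k then \<bar>c\<bar> powr r else 0)"
    by (intro sum.cong) auto
  then show ?thesis using assms real by (simp add: lp_norm_ereal powr_powr)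
qed

lemma lp_norm_zero: "m \<ge> 1 \<Longrightarrow> lp_norm p m (\<lambda>_. 0) = 0"
  using lp_norm_single[of 0 m 0] by simp

lemma lp_norm_nonneg: "m \<ge> 1 \<Longrightarrow> 0 \<le> lp_norm p m a"
  using lp_norm_mono[of m "\<lambda>_. 0" a] lp_norm_zero by simp

lemma lp_norm_abs: "lp_norm p m (\<lambda>i. \<bar>a i\<bar>) = lp_norm p m a"
  by (simp add: lp_norm_def)

lemma abs_le_lp_norm:
  assumes "k < m"
  shows "\<bar>a k\<bar> \<le> lp_norm p m a"
  using lp_norm_mono[of m "\<lambda>i. if i = k then a k else 0" a] lp_norm_single[OF assms, of "a k"] assms
  by auto

lemma lp_norm_eq_0D: "lp_norm p m a = 0 \<Longrightarrow> k < m \<Longrightarrow> a k = 0"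
  using abs_le_lp_norm[of k m a] by simp

text \<open>The functional is written down explicitly: the sign at one maximal coordinate for
  infinite p, and the normalized duality map sgn(a) (|a|/s)^(r-1) for finite p. Hahn-Banach would
  not give the last property, that the functional lives on the support of \<open>a\<close>, which
  keeps the functionals of different blocks apart.\<close>

lemma lp_norming_functional:
  assumes "m \<ge> 1"
  obtains b where "(\<Sum>i<m. b i * a i) = lp_norm p m a"
    and "\<And>x. \<bar>\<Sum>i<m. b i * x i\<bar> \<le> lp_norm p m x"
    and "\<And>i. a i = 0 \<Longrightarrow> b i = 0"
  using p
proof (cases rule: exponent_cases)
  case infinite
  have "lp_norm p m a \<in> (\<lambda>i. \<bar>a i\<bar>) ` {..<m}"
    using assms unfolding infinite lp_norm_infinity
    by (intro Max_in) (auto simp: lessThan_empty_iff)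
  then obtain k where k: "k < m" "lp_norm p m a = \<bar>a k\<bar>" by auto
  have eq: "(\<Sum>i<m. (if i = k then sgn (a k) else 0) * x i) = sgn (a k) * x k" for x
    using k(1) by (simp add: if_distrib[of "\<lambda>u. u * _"] cong: if_cong)
  show thesis
  proof
    show "(\<Sum>i<m. (if i = k then sgn (a k) else 0) * a i) = lp_norm p m a"
      using k by (simp only: eq) (simp add: abs_sgn mult.commute)
    show "\<bar>\<Sum>i<m. (if i = k then sgn (a k) else 0) * x i\<bar> \<le> lp_norm p m x" for x
      using abs_le_lp_norm[OF k(1), of x] lp_norm_nonneg[OF assms, of x]
      by (simp only: eq) (simp add: abs_mult sgn_real_def)
  qed auto
next
  case (real r)
  define S where "S x = (\<Sum>i<m. \<bar>x i\<bar> powr r)" for x :: "nat \<Rightarrow> real"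
  define s where "s = lp_norm p m a"
  have N: "lp_norm p m x powr r = S x" for x
    using real by (simp add: lp_norm_ereal S_def powr_powr sum_nonneg)
  show thesis
  proof (cases "s = 0")
    case True
    then show thesis
      using lp_norm_nonneg[OF assms] by (intro that[of "\<lambda>_. 0"]) (auto simp: s_def)
  next
    case False
    then have s: "s > 0" using lp_norm_nonneg[OF assms, of a] by (simp add: s_def)
    define b where "b i = sgn (a i) * (\<bar>a i\<bar> / s) powr (r - 1)" for i
    have b_abs: "\<bar>b i\<bar> = (\<bar>a i\<bar> / s) powr (r - 1)" for i
      by (auto simp: b_def abs_mult sgn_real_def)
    have term_eq: "\<bar>b i\<bar> * \<bar>a i\<bar> = s * (\<bar>a i\<bar> / s) powr r" for i
      using s unfolding b_abs by (cases "a i = 0") (auto simp: powr_diff)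
    have norm1: "(\<Sum>i<m. (\<bar>a i\<bar> / s) powr r) = 1"
      using N[of a] s
      by (simp add: S_def powr_divide flip: sum_divide_distrib s_def) (metis less_irrefl powr_gt_zero)
    show thesis
    proof
      have "b i * a i = \<bar>b i\<bar> * \<bar>a i\<bar>" for i
        by (auto simp: b_def abs_mult sgn_real_def)
      then have "(\<Sum>i<m. b i * a i) = (\<Sum>i<m. s * (\<bar>a i\<bar> / s) powr r)"
        by (simp add: term_eq)
      then show "(\<Sum>i<m. b i * a i) = lp_norm p m a"
        using norm1 by (simp add: s_def flip: sum_distrib_left)
    next
      fix x
      define t where "t = lp_norm p m x"
      show "\<bar>\<Sum>i<m. b i * x i\<bar> \<le> lp_norm p m x"
      proof (cases "t = 0")
        case True
        then show ?thesis
          using lp_norm_eq_0D[of m x] by (simp add: t_def)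
      next
        case False
        then have t: "t > 0" using lp_norm_nonneg[OF assms, of x] by (simp add: t_def)
        have norm2: "(\<Sum>i<m. (\<bar>x i\<bar> / t) powr r) = 1"
          using N[of x] t
          by (simp add: S_def powr_divide flip: sum_divide_distrib t_def) (metis less_irrefl powr_gt_zero)
        \<comment> \<open>Young's inequality for the normalized vectors a/s and x/t: after summation
          the right side is (1 - 1/r) + 1/r = 1, which is Hoelder's inequality.\<close>
        have "\<bar>b i\<bar> * (\<bar>x i\<bar> / t) \<le> (1 - 1 / r) * (\<bar>a i\<bar> / s) powr r + (\<bar>x i\<bar> / t) powr r / r" for i
        proof (cases "a i = 0")
          case True
          then show ?thesis using real by (simp add: b_def)
        next
          case False
          then show ?thesis
            unfolding b_abs using s t real by (intro Young_powr) auto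
        qed
        then have "(\<Sum>i<m. \<bar>b i\<bar> * (\<bar>x i\<bar> / t))
            \<le> (\<Sum>i<m. (1 - 1 / r) * (\<bar>a i\<bar> / s) powr r + (\<bar>x i\<bar> / t) powr r / r)"
          by (intro sum_mono)
        also have "\<dots> = 1"
          by (simp add: sum.distrib norm1 norm2 flip: sum_distrib_left sum_divide_distrib)
        finally have "(\<Sum>i<m. \<bar>b i\<bar> * \<bar>x i\<bar>) \<le> t"
          using t by (simp flip: sum_divide_distrib)
        moreover have "\<bar>\<Sum>i<m. b i * x i\<bar> \<le> (\<Sum>i<m. \<bar>b i\<bar> * \<bar>x i\<bar>)"
          by (rule order_trans[OF sum_abs]) (simp add: abs_mult)
        ultimately show ?thesis by (simp add: t_def)
      qed
    qed (simp add: b_def)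
  qed
qed

text \<open>Minkowski by duality: a functional that norms the sum is at most the norm on each
  summand.\<close>

lemma lp_norm_triangle:
  assumes "m \<ge> 1"
  shows "lp_norm p m (\<lambda>i. a i + b i) \<le> lp_norm p m a + lp_norm p m b"
proof -
  obtain f where f: "(\<Sum>i<m. f i * (a i + b i)) = lp_norm p m (\<lambda>i. a i + b i)"
      "\<And>x. \<bar>\<Sum>i<m. f i * x i\<bar> \<le> lp_norm p m x"
    by (rule lp_norming_functional[OF assms, of "\<lambda>i. a i + b i"]) (rule that)
  show ?thesis
    using f(1) f(2)[of a] f(2)[of b] by (simp add: ring_distribs sum.distrib)
qed

lemma lp_norm_sum_le:
  assumes "m \<ge> 1" "finite J"
  shows "lp_norm p m (\<lambda>i. \<Sum>j\<in>J. a j i) \<le> (\<Sum>j\<in>J. lp_norm p m (a j))"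
  using assms(2)
proof (induction J rule: finite_induct)
  case empty
  then show ?case using lp_norm_zero[OF assms(1)] by simp
next
  case (insert j J)
  then show ?case
    using lp_norm_triangle[OF assms(1), of "a j" "\<lambda>i. \<Sum>j\<in>J. a j i"] by simp
qed

text \<open>The blocks have disjoint supports, so the space is the l^p sum of its blocks. This is
  the feature of l^p that lets the grouping by \<open>c\<close> be undone without loss of
  norm.\<close>

lemma lp_norm_blocks:
  assumes "m \<ge> 1" "\<And>i. i < m \<Longrightarrow> c i < M"
  shows "lp_norm p M (\<lambda>k. lp_norm p m (block c k a)) = lp_norm p m a"
  using p
proof (cases rule: exponent_cases)
  case infinite
  have M: "M \<ge> 1" using assms(2)[of 0] assms(1) by simp
  show ?thesis
  proof (rule antisym)
    have "lp_norm p m (block c k a) \<le> lp_norm p m a" for k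
      by (intro lp_norm_mono assms(1)) (auto simp: block_def)
    then show "lp_norm p M (\<lambda>k. lp_norm p m (block c k a)) \<le> lp_norm p m a"
      unfolding infinite lp_norm_infinity[of M]
      using M lp_norm_nonneg[OF assms(1)]
      by (subst Max_le_iff) (auto simp: lessThan_empty_iff infinite)
    have "\<bar>a i\<bar> \<le> lp_norm p M (\<lambda>k. lp_norm p m (block c k a))" if "i < m" for i
      using abs_le_lp_norm[OF that, of "block c (c i) a"]
        abs_le_lp_norm[OF assms(2)[OF that], of "\<lambda>k. lp_norm p m (block c k a)"]
      by (simp add: block_def)
    then show "lp_norm p m a \<le> lp_norm p M (\<lambda>k. lp_norm p m (block c k a))"
      unfolding infinite lp_norm_infinity[of m a]
      using assms(1) by (subst Max_le_iff) (auto simp: lessThan_empty_iff infinite)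
  qed
next
  case (real r)
  have "lp_norm p m (block c k a) powr r = (\<Sum>i\<in>{i \<in> {..<m}. c i = k}. \<bar>a i\<bar> powr r)" for k
  proof -
    have "lp_norm p m (block c k a) powr r = (\<Sum>i<m. \<bar>block c k a i\<bar> powr r)"
      using real by (simp add: lp_norm_ereal powr_powr sum_nonneg)
    also have "\<dots> = (\<Sum>i<m. if c i = k then \<bar>a i\<bar> powr r else 0)"
      by (intro sum.cong) (auto simp: block_def)
    finally show ?thesis by (simp only: sum.inter_filter finite_lessThan)
  qed
  then have "(\<Sum>k<M. \<bar>lp_norm p m (block c k a)\<bar> powr r)
      = (\<Sum>k<M. \<Sum>i\<in>{i \<in> {..<m}. c i = k}. \<bar>a i\<bar> powr r)"
    using lp_norm_nonneg[OF assms(1)] by simp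
  also have "\<dots> = (\<Sum>i<m. \<bar>a i\<bar> powr r)"
    using assms(2) by (intro sum.group) auto
  finally have "(\<Sum>k<M. \<bar>lp_norm p m (block c k a)\<bar> powr r) = (\<Sum>i<m. \<bar>a i\<bar> powr r)" .
  then show ?thesis using real by (simp add: lp_norm_ereal)
qed

lemma lp_op_norm_le_1:
  assumes "n \<ge> 1" "\<And>a. lp_norm p m (apply_matrix m n t a) \<le> lp_norm p n a"
  shows "lp_op_norm p m n t \<le> 1"
  unfolding lp_op_norm_def
proof (rule cSUP_least)
  show "lp_ball p n \<noteq> {}"
    using zero_tuples lp_norm_zero[OF assms(1)] by (force simp: lp_ball_def)
qed (use assms(2) in \<open>force simp: lp_ball_def intro: order_trans\<close>)

text \<open>The normalized blocks of \<open>l\<close> span a norm-one complemented copy of the M-dimensional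
  space of scalar tuples: \<open>V\<close> is the embedding and \<open>P\<close> applies the norming functionals of the
  blocks.\<close>

lemma block_factorization:
  fixes l :: "nat \<Rightarrow> real"
  assumes "m \<ge> 1" "\<And>i. i < m \<Longrightarrow> c i < M"
  obtains P V where "lp_op_norm p M m P \<le> 1" "lp_op_norm p m M V \<le> 1"
    "\<And>g i. i < m \<Longrightarrow>
      apply_matrix m M V (apply_matrix M m P (\<lambda>i. l i * g (c i))) i = l i * g (c i)"
proof -
  have M: "M \<ge> 1" using assms(2)[of 0] assms(1) by simp
  define s where "s k = lp_norm p m (block c k l)" for k
  have "\<exists>b. (\<Sum>i<m. b i * block c k l i) = s k \<and> (\<forall>x. \<bar>\<Sum>i<m. b i * x i\<bar> \<le> lp_norm p m x) \<and>
      (\<forall>i. block c k l i = 0 \<longrightarrow> b i = 0)" for k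
    unfolding s_def
    by (rule lp_norming_functional[OF assms(1), of "block c k l"]) (intro exI conjI allI impI)
  then have "\<exists>P. \<forall>k. (\<Sum>i<m. P k i * block c k l i) = s k \<and>
      (\<forall>x. \<bar>\<Sum>i<m. P k i * x i\<bar> \<le> lp_norm p m x) \<and> (\<forall>i. block c k l i = 0 \<longrightarrow> P k i = 0)"
    by (intro choice allI)
  then obtain P where P_all: "\<forall>k. (\<Sum>i<m. P k i * block c k l i) = s k \<and>
      (\<forall>x. \<bar>\<Sum>i<m. P k i * x i\<bar> \<le> lp_norm p m x) \<and> (\<forall>i. block c k l i = 0 \<longrightarrow> P k i = 0)"
    by (rule exE)
  have P: "\<And>k. (\<Sum>i<m. P k i * block c k l i) = s k"
      "\<And>k x. \<bar>\<Sum>i<m. P k i * x i\<bar> \<le> lp_norm p m x"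
      "\<And>k i. block c k l i = 0 \<Longrightarrow> P k i = 0"
    using P_all by blast+
  have P0: "P k i = 0" if "c i \<noteq> k" for k i
    using that by (intro P(3)) (simp add: block_def)
  \<comment> \<open>If block k of \<open>l\<close> is zero, then \<open>s k = 0\<close> and division
    by zero makes the whole column zero, in accordance with \<open>l\<close> vanishing
    there.\<close>
  define V where "V i k = (if c i = k then l i / s k else 0)" for i k
  have V: "apply_matrix m M V a i = l i / s (c i) * a (c i)" if "i < m" for a :: "nat \<Rightarrow> real" and i
    using that assms(2)[OF that]
    by (simp add: apply_matrix_def pairing_def V_def if_distrib[of "\<lambda>u. u * _"] cong: if_cong)
  show thesis
  proof
    show "lp_op_norm p M m P \<le> 1"
    proof (rule lp_op_norm_le_1[OF assms(1)])
      fix a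
      \<comment> \<open>Row k of \<open>P\<close> sees only block k and is a functional of norm at
        most 1, so it is dominated by the norm of that block.\<close>
      have "\<bar>apply_matrix M m P a k\<bar> \<le> \<bar>lp_norm p m (block c k a)\<bar>" if "k < M" for k
      proof -
        have "(\<Sum>i<m. P k i * a i) = (\<Sum>i<m. P k i * block c k a i)"
          using P0 by (intro sum.cong) (auto simp: block_def)
        then show ?thesis
          using that P(2)[of k "block c k a"] by (simp add: apply_matrix_def pairing_def)
      qed
      then have "lp_norm p M (apply_matrix M m P a) \<le> lp_norm p M (\<lambda>k. lp_norm p m (block c k a))"
        by (intro lp_norm_mono M)
      then show "lp_norm p M (apply_matrix M m P a) \<le> lp_norm p m a"
        by (simp add: lp_norm_blocks[OF assms])
    qed
    show "lp_op_norm p m M V \<le> 1"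
    proof (rule lp_op_norm_le_1[OF M])
      fix a
      \<comment> \<open>Block k of the image is a multiple of block k of \<open>l\<close>,
        normalized by its norm. There is equality unless \<open>s k = 0\<close>, and then the left
        side is 0.\<close>
      have "lp_norm p m (block c k (apply_matrix m M V a)) \<le> \<bar>a k\<bar>" for k
      proof -
        have "lp_norm p m (block c k (apply_matrix m M V a))
            = lp_norm p m (\<lambda>i. a k / s k * block c k l i)"
          by (intro lp_norm_cong) (auto simp: block_def V)
        then show ?thesis
          using lp_norm_scale[OF assms(1), of "a k / s k" "block c k l"]
            lp_norm_nonneg[OF assms(1), of "block c k l"]
          by (simp add: s_def abs_mult)
      qed
      then have "lp_norm p M (\<lambda>k. lp_norm p m (block c k (apply_matrix m M V a))) \<le> lp_norm p M a"
        using lp_norm_nonneg[OF assms(1)] by (intro lp_norm_mono M) simp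
      then show "lp_norm p m (apply_matrix m M V a) \<le> lp_norm p M a"
        by (simp add: lp_norm_blocks[OF assms])
    qed
    fix g i assume i: "i < m"
    have "(\<Sum>j<m. P (c i) j * (l j * g (c j))) = (\<Sum>j<m. P (c i) j * block c (c i) l j * g (c i))"
      using P0 by (intro sum.cong) (auto simp: block_def)
    then have "apply_matrix M m P (\<lambda>i. l i * g (c i)) (c i) = s (c i) * g (c i)"
      using assms(2)[OF i] P(1)[of "c i"]
      by (simp add: apply_matrix_def pairing_def flip: sum_distrib_right)
    moreover have "l i = 0" if "s (c i) = 0"
      using lp_norm_eq_0D[OF that[unfolded s_def] i] by (simp add: block_def)
    ultimately show "apply_matrix m M V (apply_matrix M m P (\<lambda>i. l i * g (c i))) i = l i * g (c i)"
      using V[OF i] by auto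
  qed
qed

end

subsection \<open>A nearly Auerbach basis\<close>

text \<open>Tychonoff's theorem: coefficient families are functions on all naturals, and the product
  topology makes each coordinate continuous.\<close>

lemma compact_box_fun: "compact {a :: nat \<Rightarrow> real. \<forall>i. a i \<in> {-1..1}}"
proof -
  have "compactin (product_topology (\<lambda>_. euclidean) UNIV) (PiE UNIV (\<lambda>_::nat. {-1..1::real}))"
    by (subst compactin_PiE) (auto simp: compactin_euclidean_iff)
  moreover have "PiE UNIV (\<lambda>_::nat. {-1..1::real}) = {a. \<forall>i. a i \<in> {-1..1}}"
    by (auto simp: PiE_def)
  ultimately show ?thesis
    by (simp add: euclidean_product_topology flip: compactin_euclidean_iff)
qed

text \<open>By independence the norm of the combination does not vanish on the compact sup-norm
  sphere \<open>S\<close>, so it has a positive minimum there; homogeneity gives the bound for all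
  coefficients.\<close>

lemma coefficients_bounded:
  fixes b :: "nat \<Rightarrow> 'b::real_normed_vector"
  assumes indep: "\<And>a. (\<Sum>i<n. a i *\<^sub>R b i) = 0 \<Longrightarrow> \<forall>i<n. a i = 0"
  obtains C where "C > 0" "\<And>a i. i < n \<Longrightarrow> \<bar>a i\<bar> \<le> C * norm (\<Sum>i<n. a i *\<^sub>R b i)"
proof (cases "n = 0")
  case True
  then show thesis by (intro that[of 1]) auto
next
  case False
  define S where "S = (\<Union>k<n. {a :: nat \<Rightarrow> real. (\<forall>i. a i \<in> {-1..1}) \<and> \<bar>a k\<bar> = 1})"
  define F where "F a = norm (\<Sum>i<n. a i *\<^sub>R b i)" for a
  have cont: "continuous_on A (\<lambda>a :: nat \<Rightarrow> real. a i)" for i A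
    by (rule continuous_on_subset[OF continuous_on_product_coordinates subset_UNIV])
  have closed: "closed {a :: nat \<Rightarrow> real. \<bar>a k\<bar> = 1}" for k
    using closed_Collect_eq[of "\<lambda>a. \<bar>a k\<bar>" "\<lambda>_. 1", OF continuous_on_rabs[OF cont] continuous_on_const] .
  have "compact {a :: nat \<Rightarrow> real. (\<forall>i. a i \<in> {-1..1}) \<and> \<bar>a k\<bar> = 1}" for k
    using compact_Int_closed[OF compact_box_fun closed[of k]] by (simp only: Collect_conj_eq)
  then have "compact S" unfolding S_def by (intro compact_UN) auto
  moreover have "(\<lambda>_. 1) \<in> S" using False by (auto simp: S_def)
  moreover have "continuous_on S F"
    unfolding F_def
    by (intro continuous_on_norm continuous_on_sum continuous_on_scaleR continuous_on_const cont)
  ultimately obtain a0 where a0: "a0 \<in> S" "\<And>a. a \<in> S \<Longrightarrow> F a0 \<le> F a"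
    using continuous_attains_inf[of S F] by blast
  have pos: "F a0 > 0"
    using indep[of a0] a0(1) by (fastforce simp: F_def S_def)
  show thesis
  proof
    fix a :: "nat \<Rightarrow> real" and i assume i: "i < n"
    define r where "r = Max ((\<lambda>i. \<bar>a i\<bar>) ` {..<n})"
    have "r \<in> (\<lambda>i. \<bar>a i\<bar>) ` {..<n}"
      unfolding r_def using False by (intro Max_in) auto
    then obtain k where k: "k < n" "r = \<bar>a k\<bar>" by auto
    have r: "\<bar>a j\<bar> \<le> r" if "j < n" for j
      unfolding r_def using that by (intro Max_ge) auto
    show "\<bar>a i\<bar> \<le> 1 / F a0 * norm (\<Sum>i<n. a i *\<^sub>R b i)"
    proof (cases "r = 0")
      case True
      then show ?thesis using r[OF i] pos by simp
    next
      case False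
      then have rpos: "r > 0" using k by simp
      \<comment> \<open>Cut off at n, because \<open>a\<close> is arbitrary beyond n whereas
        elements of \<open>S\<close> are bounded in every coordinate.\<close>
      define a' where "a' j = (if j < n then a j / r else 0)" for j
      have "\<bar>a' j\<bar> \<le> 1" for j
        using r[of j] rpos by (simp add: a'_def)
      moreover have "\<bar>a' k\<bar> = 1"
        using k rpos by (simp add: a'_def)
      ultimately have "a' \<in> S"
        using k(1) by (auto simp: S_def abs_le_iff minus_le_iff)
      then have "F a0 \<le> F a'" by (rule a0(2))
      also have "F a' = F a / r"
      proof -
        have "(\<Sum>i<n. a' i *\<^sub>R b i) = (1 / r) *\<^sub>R (\<Sum>i<n. a i *\<^sub>R b i)"
          unfolding scaleR_sum_right by (intro sum.cong) (auto simp: a'_def)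
        then show ?thesis using rpos by (simp add: F_def)
      qed
      finally have "r \<le> F a / F a0" using rpos pos by (simp add: field_simps)
      then show ?thesis using r[OF i] by (simp add: F_def)
    qed
  qed (use pos in simp)
qed

text \<open>The cofactors of column j do not involve column j, so the determinant is linear in that
  column. This yields the linearity of the Cramer quotients that serve as coordinate
  functionals.\<close>

lemma det_column_update:
  fixes a :: "nat \<Rightarrow> nat \<Rightarrow> 'c::comm_ring_1"
  assumes "j < n"
  shows "Determinant.det (mat n n (\<lambda>(i, k). if k = j then y i else a i k))
    = (\<Sum>i<n. y i * cofactor (mat n n (\<lambda>(i, k). a i k)) i j)"
proof -
  have "mat_delete (mat n n (\<lambda>(i, k). if k = j then y i else a i k)) i j
      = mat_delete (mat n n (\<lambda>(i, k). a i k)) i j" if "i < n" for i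
    using assms that by (auto simp: mat_delete_def intro!: eq_matI)
  then show ?thesis
    using assms
    by (subst laplace_expansion_column[OF _ assms]) (auto simp: cofactor_def intro!: sum.cong)
qed

text \<open>A crude bound from the Leibniz formula; it serves only to make the supremum of the
  determinants finite.\<close>

lemma det_bounded:
  fixes y :: "nat \<Rightarrow> nat \<Rightarrow> real"
  assumes "\<And>i j. i < n \<Longrightarrow> j < n \<Longrightarrow> \<bar>y i j\<bar> \<le> C"
  shows "\<bar>Determinant.det (mat n n (\<lambda>(i, j). y i j))\<bar> \<le> (\<Sum>\<pi> | \<pi> permutes {0..<n}. C ^ n)"
proof -
  have "\<bar>signof \<pi> * (\<Prod>i = 0..<n. mat n n (\<lambda>(i, j). y i j) $$ (i, \<pi> i))\<bar> \<le> C ^ n"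
    if "\<pi> permutes {0..<n}" for \<pi>
  proof -
    have \<pi>: "\<pi> i < n" if "i < n" for i
      using \<open>\<pi> permutes {0..<n}\<close> that by (metis atLeastLessThan_iff permutes_in_image zero_le)
    have "\<bar>signof \<pi> * (\<Prod>i = 0..<n. mat n n (\<lambda>(i, j). y i j) $$ (i, \<pi> i))\<bar>
        = (\<Prod>i = 0..<n. \<bar>y i (\<pi> i)\<bar>)"
      using \<pi> by (simp add: abs_mult abs_prod sign_def)
    also have "\<dots> \<le> (\<Prod>i = 0..<n. C)"
      by (intro prod_mono) (use assms \<pi> in auto)
    finally show ?thesis by simp
  qed
  then show ?thesis
    unfolding det_def'[OF mat_carrier]
    by (intro order_trans[OF sum_abs] sum_mono) auto
qed

text \<open>A nearly determinant-maximizing family in the unit ball has biorthogonal functionals of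
  norm at most 2 (Auerbach's argument, with the supremum not attained).\<close>

lemma near_Auerbach_basis:
  fixes E :: "'b::real_normed_vector set"
  assumes E: "subspace E" and dim: "dim E = n" and n: "n \<ge> 1"
  obtains e :: "nat \<Rightarrow> 'b" and \<phi> :: "nat \<Rightarrow> 'b \<Rightarrow> real"
  where "\<And>j. j < n \<Longrightarrow> norm (e j) \<le> 1"
    and "\<And>j. j < n \<Longrightarrow> linear (\<phi> j)"
    and "\<And>j x. j < n \<Longrightarrow> x \<in> E \<Longrightarrow> \<bar>\<phi> j x\<bar> \<le> 2 * norm x"
    and "\<And>x. x \<in> E \<Longrightarrow> x = (\<Sum>j<n. \<phi> j x *\<^sub>R e j)"
proof -
  obtain B where B: "B \<subseteq> E" "independent B" "E \<subseteq> span B" "card B = n"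
    using basis_exists[of E] dim by metis
  \<comment> \<open>The cardinality of an infinite set is 0 by convention, so
    \<open>n \<ge> 1\<close> yields finiteness.\<close>
  have finB: "finite B" using B(4) n card.infinite by fastforce
  obtain b where b: "bij_betw b {..<n} B"
    using ex_bij_betw_nat_finite[OF finB] B(4) by (auto simp: atLeast0LessThan)
  have sumB: "(\<Sum>v\<in>B. f v) = (\<Sum>i<n. f (b i))" for f :: "'b \<Rightarrow> 'b"
    using sum.reindex_bij_betw[OF b, of f] by simp
  have bB: "b i \<in> B" if "i < n" for i using b that bij_betwE by fastforce
  have indep: "\<forall>i<n. a i = 0" if "(\<Sum>i<n. a i *\<^sub>R b i) = 0" for a
  proof -
    define a' where "a' v = a (the_inv_into {..<n} b v)" for v
    have a': "a' (b i) = a i" if "i < n" for i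
      using b that by (simp add: a'_def the_inv_into_f_f bij_betw_def)
    have sum0: "(\<Sum>v\<in>B. a' v *\<^sub>R v) = 0" using that by (simp add: sumB a')
    have "a' (b i) = 0" if "i < n" for i
      by (rule independentD[OF B(2) finB subset_refl sum0 bB[OF that]])
    then show ?thesis using a' by simp
  qed
  obtain C where C: "C > 0" "\<And>a i. i < n \<Longrightarrow> \<bar>a i\<bar> \<le> C * norm (\<Sum>i<n. a i *\<^sub>R b i)"
    by (rule coefficients_bounded[where b = b and n = n, OF indep]) (assumption, rule that)
  \<comment> \<open>The extension to the whole space is purely algebraic and may be unbounded there.
    Bounds are claimed on \<open>E\<close> only, which suffices because the functionals will be
    composed with an operator into \<open>E\<close>.\<close>
  have "\<exists>g :: nat \<Rightarrow> 'b \<Rightarrow> real. \<forall>i. linear (g i) \<and> (\<forall>v\<in>B. g i v = (if v = b i then 1 else 0))"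
    by (intro choice allI linear_independent_extend[OF B(2)])
  then obtain g :: "nat \<Rightarrow> 'b \<Rightarrow> real"
    where g_all: "\<forall>i. linear (g i) \<and> (\<forall>v\<in>B. g i v = (if v = b i then 1 else 0))"
    by (rule exE)
  have g: "linear (g i)" "v \<in> B \<Longrightarrow> g i v = (if v = b i then 1 else 0)" for i v
    using g_all by blast+
  have inj: "b i = b j \<longleftrightarrow> i = j" if "i < n" "j < n" for i j
    using b that by (auto simp: bij_betw_def inj_on_def)
  have gb: "g i (b j) = (if i = j then 1 else 0)" if "i < n" "j < n" for i j
    using g(2)[OF bB[OF that(2)]] inj[OF that] by auto
  have expand: "x = (\<Sum>i<n. g i x *\<^sub>R b i)" if "x \<in> E" for x
  proof -
    have "x \<in> range (\<lambda>a. \<Sum>v\<in>B. a v *\<^sub>R v)"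
      using subsetD[OF B(3) that] unfolding span_finite[OF finB] .
    then obtain a where a: "x = (\<Sum>v\<in>B. a v *\<^sub>R v)"
      by (rule imageE)
    have "g i x = a (b i)" if "i < n" for i
      using that by (simp add: a sumB linear_sum[OF g(1)] linear_scale[OF g(1)] gb
          if_distrib[of "\<lambda>u. _ * u"] cong: if_cong)
    then show ?thesis by (simp add: a sumB)
  qed
  have gC: "\<bar>g i x\<bar> \<le> C * norm x" if "x \<in> E" "i < n" for x i
    using C(2)[OF that(2), of "\<lambda>i. g i x"] expand[OF that(1)] by simp
  define D where "D v = Determinant.det (mat n n (\<lambda>(i, j). g i (v j)))" for v :: "nat \<Rightarrow> 'b"
  define \<V> where "\<V> = {v. \<forall>j<n. v j \<in> E \<and> norm (v j) \<le> 1}"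
  have bdd: "bdd_above ((\<lambda>v. \<bar>D v\<bar>) ` \<V>)"
  proof (rule bdd_aboveI2)
    fix v assume v: "v \<in> \<V>"
    have "\<bar>g i (v j)\<bar> \<le> C" if "i < n" "j < n" for i j
      using gC[of "v j" i] v that mult_left_mono[of "norm (v j)" 1 C] C(1)
      by (auto simp: \<V>_def intro: order_trans)
    then show "\<bar>D v\<bar> \<le> (\<Sum>\<pi> | \<pi> permutes {0..<n}. C ^ n)"
      unfolding D_def by (rule det_bounded)
  qed
  define s where "s = (SUP v\<in>\<V>. \<bar>D v\<bar>)"
  have s_ge: "\<bar>D v\<bar> \<le> s" if "v \<in> \<V>" for v
    unfolding s_def by (rule cSUP_upper[OF that bdd])
  have b0: "b i \<noteq> 0" if "i < n" for i
    using bB[OF that] B(2) dependent_zero by metis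
  \<comment> \<open>The normalized basis has a diagonal matrix with nonzero entries, so the supremum
    \<open>s\<close> is positive and some family exceeds half of it.\<close>
  define b' where "b' i = (1 / norm (b i)) *\<^sub>R b i" for i
  have b': "b' \<in> \<V>"
    using bB B(1) b0 by (auto simp: \<V>_def b'_def simp del: scaleR_eq_0_iff intro: subspace_scale[OF E])
  have "D b' = (\<Prod>i<n. 1 / norm (b i))"
  proof -
    have "upper_triangular (mat n n (\<lambda>(i, j). g i (b' j)))"
      by (auto simp: b'_def linear_scale[OF g(1)] gb)
    then have "D b' = prod_list (diag_mat (mat n n (\<lambda>(i, j). g i (b' j))))"
      unfolding D_def by (rule det_upper_triangular[OF _ mat_carrier])
    also have "\<dots> = (\<Prod>i<n. g i (b' i))"
      by (simp add: prod_list_diag_prod atLeast0LessThan)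
    finally show ?thesis by (simp add: b'_def linear_scale[OF g(1)] gb)
  qed
  then have "D b' \<noteq> 0" using b0 by simp
  then have "s > 0" using s_ge[OF b'] by simp
  then have "s / 2 < s" by simp
  \<comment> \<open>Source of the factor 2 in the bound on the functionals: replacing one vector of
    \<open>e\<close> by another unit vector can raise |D| at most to \<open>s\<close>, which is less
    than twice |D e|.\<close>
  then obtain e where e: "e \<in> \<V>" "s / 2 < \<bar>D e\<bar>"
    unfolding s_def using less_cSUP_iff[OF _ bdd] b' by blast
  then have De: "D e \<noteq> 0" using \<open>s > 0\<close> by auto
  \<comment> \<open>Cramer's rule for the j-th coordinate with respect to \<open>e\<close>.\<close>
  define \<phi> where "\<phi> j x = D (e(j := x)) / D e" for j x
  have D_lin: "D (e(j := x)) = (\<Sum>i<n. g i x * cofactor (mat n n (\<lambda>(i, k). g i (e k))) i j)"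
    if j: "j < n" for j x
  proof -
    have "mat n n (\<lambda>(i, k). g i ((e(j := x)) k)) = mat n n (\<lambda>(i, k). if k = j then g i x else g i (e k))"
      by (rule eq_matI) auto
    then show ?thesis
      using det_column_update[OF j, of "\<lambda>i. g i x" "\<lambda>i k. g i (e k)"] by (simp only: D_def)
  qed
  have lin: "linear (\<phi> j)" if "j < n" for j
  proof (rule linearI)
    show "\<phi> j (x + y) = \<phi> j x + \<phi> j y" for x y
      by (simp add: \<phi>_def D_lin[OF that] linear_add[OF g(1)] ring_distribs sum.distrib add_divide_distrib)
    show "\<phi> j (c *\<^sub>R x) = c *\<^sub>R \<phi> j x" for c x
      by (simp add: \<phi>_def D_lin[OF that] linear_scale[OF g(1)] sum_distrib_left mult.assoc)
  qed
  have biorth: "\<phi> j (e k) = (if j = k then 1 else 0)" if "j < n" "k < n" for j k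
  proof (cases "j = k")
    case True
    then show ?thesis using De by (simp add: \<phi>_def)
  next
    case False
    have "D (e(j := e k)) = 0"
      unfolding D_def
      by (rule det_identical_columns[OF _ False that]) (use that in \<open>auto simp: fun_eq_iff intro!: eq_vecI\<close>)
    then show ?thesis using False by (simp add: \<phi>_def)
  qed
  have eE: "e j \<in> E" "norm (e j) \<le> 1" if "j < n" for j
    using e(1) that by (auto simp: \<V>_def)
  have bound: "\<bar>\<phi> j x\<bar> \<le> 2 * norm x" if "j < n" "x \<in> E" for j x
  proof (cases "x = 0")
    case True
    then show ?thesis using linear_0[OF lin[OF that(1)]] by simp
  next
    case False
    define x' where "x' = (1 / norm x) *\<^sub>R x"
    have "e(j := x') \<in> \<V>"
      using eE that E False by (auto simp: \<V>_def x'_def intro!: subspace_scale)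
    then have "\<bar>D (e(j := x'))\<bar> \<le> 2 * \<bar>D e\<bar>"
      using s_ge e(2) by fastforce
    then have "\<bar>\<phi> j x'\<bar> \<le> 2"
      using De by (simp add: \<phi>_def field_simps)
    then show ?thesis
      using False by (simp add: x'_def linear_scale[OF lin[OF that(1)]] abs_mult field_simps)
  qed
  have "inj_on e {..<n}"
  proof (rule inj_onI)
    fix j k assume "j \<in> {..<n}" "k \<in> {..<n}" "e j = e k"
    then show "j = k" using biorth[of j j] biorth[of j k] by (auto split: if_splits)
  qed
  have expand_e: "x = (\<Sum>j<n. \<phi> j x *\<^sub>R e j)" if x: "x \<in> E" for x
  proof (rule ccontr)
    assume neq: "x \<noteq> (\<Sum>j<n. \<phi> j x *\<^sub>R e j)"
    \<comment> \<open>The remainder is annihilated by every functional. If it were nonzero, it would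
      form with \<open>e\<close> a family of n + 1 independent vectors in the span of the n vectors
      of \<open>B\<close>.\<close>
    define y where "y = x - (\<Sum>j<n. \<phi> j x *\<^sub>R e j)"
    have yE: "y \<in> E"
      unfolding y_def using E x eE by (intro subspace_diff subspace_sum subspace_scale) auto
    have y0: "\<phi> k y = 0" if "k < n" for k
      using that by (simp add: y_def linear_diff[OF lin] linear_sum[OF lin] linear_scale[OF lin] biorth
          if_distrib[of "\<lambda>u. _ * u"] cong: if_cong)
    have coef: "(\<forall>j<n. a j = 0) \<and> d = 0" if "(\<Sum>j<n. a j *\<^sub>R e j) + d *\<^sub>R y = 0" for a d
    proof -
      have "a k = 0" if k: "k < n" for k
      proof -
        have "\<phi> k ((\<Sum>j<n. a j *\<^sub>R e j) + d *\<^sub>R y) = a k"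
          using k by (simp add: linear_add[OF lin] linear_sum[OF lin] linear_scale[OF lin] biorth y0
            if_distrib[of "\<lambda>u. _ * u"] cong: if_cong)
        then show ?thesis using \<open>_ = 0\<close> linear_0[OF lin[OF k]] by simp
      qed
      moreover have "y \<noteq> 0" using neq by (simp add: y_def)
      ultimately show ?thesis using that by simp
    qed
    have y_notin: "y \<notin> e ` {..<n}"
      using y0 biorth by fastforce
    have "independent (insert y (e ` {..<n}))"
    proof (rule ccontr)
      assume "\<not> independent (insert y (e ` {..<n}))"
      then obtain u v where u: "(\<Sum>v\<in>insert y (e ` {..<n}). u v *\<^sub>R v) = 0"
        and v: "v \<in> insert y (e ` {..<n})" "u v \<noteq> 0"
        unfolding not_not by (subst (asm) dependent_finite) auto
      have "(\<Sum>j<n. u (e j) *\<^sub>R e j) + u y *\<^sub>R y = 0"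
        using u y_notin \<open>inj_on e {..<n}\<close> by (simp add: sum.reindex add.commute)
      from coef[OF this] show False using v by auto
    qed
    moreover have "insert y (e ` {..<n}) \<subseteq> span B"
      using yE eE B(3) by auto
    ultimately have "card (insert y (e ` {..<n})) \<le> card B"
      using independent_span_bound[OF finB] by blast
    then show False
      using y_notin \<open>inj_on e {..<n}\<close> B(4) by (simp add: card_image)
  qed
  show thesis by (rule that[OF eE(2) lin bound expand_e])
qed

subsection \<open>Quantizing the directions\<close>

lemma unit_interval_grid:
  fixes u :: real
  assumes "\<bar>u\<bar> \<le> 1" "K \<ge> 1"
  obtains k where "k < 2 * K" "\<bar>u - (real k / real K - 1)\<bar> \<le> 1 / real K"
proof -
  define v where "v = (u + 1) * real K"
  have K: "real K \<ge> 1" using assms(2) by simp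
  have v: "0 \<le> v" "v \<le> 2 * real K"
    using assms K by (auto simp: v_def abs_le_iff)
  obtain k where k: "k < 2 * K" "\<bar>v - real k\<bar> \<le> 1"
  proof (cases "v < 2 * real K")
    case True
    then have "nat \<lfloor>v\<rfloor> < 2 * K" using v by linarith
    moreover have "\<bar>v - real (nat \<lfloor>v\<rfloor>)\<bar> \<le> 1" using v by linarith
    ultimately show ?thesis by (rule that)
  next
    \<comment> \<open>Only u = 1 is left. The grid has no point at 1, but its last point 1 - 1/K is
      at the permitted distance 1/K; this keeps the count at 2K per coordinate.\<close>
    case False
    then show ?thesis
      using v assms(2) by (intro that[of "2 * K - 1"]) (auto simp: of_nat_diff)
  qed
  have "u - (real k / real K - 1) = (v - real k) / real K"
    using K by (simp add: v_def field_simps)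
  then have "\<bar>u - (real k / real K - 1)\<bar> \<le> 1 / real K"
    using k(2) K by (simp add: divide_right_mono)
  then show thesis using k(1) that by blast
qed

text \<open>The grid points in the n-dimensional cube are numbered, \<open>c i\<close> is the number
  of the point chosen for index i, and \<open>g j\<close> decodes its j-th coordinate. The rounded
  value thus depends on i only through \<open>c i\<close>, as \<open>block_factorization\<close>
  requires.\<close>

lemma grid_quantization:
  fixes u :: "nat \<Rightarrow> nat \<Rightarrow> real"
  assumes "\<And>j i. j < n \<Longrightarrow> \<bar>u j i\<bar> \<le> 1" and K: "K \<ge> 1"
  obtains c :: "nat \<Rightarrow> nat" and g :: "nat \<Rightarrow> nat \<Rightarrow> real"
  where "\<And>i. c i < (2 * K) ^ n"
    and "\<And>j i. j < n \<Longrightarrow> \<bar>u j i - g j (c i)\<bar> \<le> 1 / real K"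
proof -
  define good where "good j i k \<longleftrightarrow> k < 2 * K \<and> \<bar>u j i - (real k / real K - 1)\<bar> \<le> 1 / real K" for j i k
  define k where "k j i = (SOME k. good j i k)" for j i
  have ex: "\<exists>k. good j i k" if "j < n" for j i
    unfolding good_def by (rule unit_interval_grid[OF assms(1)[OF that] K]) (intro exI conjI)
  have "good j i (k j i)" if "j < n" for j i
    unfolding k_def by (rule someI_ex[OF ex[OF that]])
  then have k: "k j i < 2 * K" "\<bar>u j i - (real (k j i) / real K - 1)\<bar> \<le> 1 / real K"
    if "j < n" for j i
    using that by (simp_all add: good_def)
  define \<Q> where "\<Q> = PiE {..<n} (\<lambda>_. {..<2 * K})"
  have "finite \<Q>" "card \<Q> = (2 * K) ^ n"
    by (auto simp: \<Q>_def card_PiE intro: finite_PiE)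
  then obtain h where h: "bij_betw h \<Q> {..<(2 * K) ^ n}"
    using ex_bij_betw_finite_nat[of \<Q>] by (auto simp: atLeast0LessThan)
  define q where "q i = restrict (\<lambda>j. k j i) {..<n}" for i
  have q: "q i \<in> \<Q>" for i using k(1) by (auto simp: q_def \<Q>_def)
  show thesis
  proof
    show "h (q i) < (2 * K) ^ n" for i using h q bij_betwE by fastforce
    fix j i assume j: "j < n"
    have "the_inv_into \<Q> h (h (q i)) = q i"
      using h q by (intro the_inv_into_f_f) (auto simp: bij_betw_def)
    then show "\<bar>u j i - (real (the_inv_into \<Q> h (h (q i)) j) / real K - 1)\<bar> \<le> 1 / real K"
      using k(2)[OF j] j by (simp add: q_def)
  qed
qed

section \<open>Norm estimates in a p-multinormed space\<close>

context multinormed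
begin

lemma N_zero: "m \<ge> 1 \<Longrightarrow> N m (\<lambda>_. 0) = 0"
  using norm[of m] zero_tuples[of m] by (auto simp: is_norm_on_tuples_def)

lemma N_nonneg: "m \<ge> 1 \<Longrightarrow> w \<in> tuples m \<Longrightarrow> 0 \<le> N m w"
  using norm[of m] by (auto simp: is_norm_on_tuples_def)

lemma N_scale: "m \<ge> 1 \<Longrightarrow> w \<in> tuples m \<Longrightarrow> N m (\<lambda>i. c *\<^sub>R w i) = \<bar>c\<bar> * N m w"
  using norm[of m] by (auto simp: is_norm_on_tuples_def)

lemma N_triangle:
  "m \<ge> 1 \<Longrightarrow> v \<in> tuples m \<Longrightarrow> w \<in> tuples m \<Longrightarrow> N m (\<lambda>i. v i + w i) \<le> N m v + N m w"
  using norm[of m] by (auto simp: is_norm_on_tuples_def)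

lemma N_triangle_diff:
  assumes "m \<ge> 1" "v \<in> tuples m" "w \<in> tuples m"
  shows "N m (\<lambda>i. v i - w i) \<le> N m v + N m w"
proof -
  have "(\<lambda>i. (-1) *\<^sub>R w i) \<in> tuples m" using assms(3) by (simp add: tuples_def)
  from N_triangle[OF assms(1,2) this] show ?thesis
    using N_scale[OF assms(1,3), of "-1"] by simp
qed

lemma N_sum_le:
  assumes "m \<ge> 1" "finite J" "\<And>j. j \<in> J \<Longrightarrow> v j \<in> tuples m"
  shows "N m (\<lambda>i. \<Sum>j\<in>J. v j i) \<le> (\<Sum>j\<in>J. N m (v j))"
  using assms(2,3)
proof (induction J rule: finite_induct)
  case empty
  then show ?case using N_zero[OF assms(1)] by simp
next
  case (insert j J)
  have "(\<lambda>i. \<Sum>j\<in>J. v j i) \<in> tuples m"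
    using insert.prems by (simp add: tuples_def)
  then show ?case
    using N_triangle[OF assms(1), of "v j" "\<lambda>i. \<Sum>j\<in>J. v j i"] insert by fastforce
qed

lemma N_contraction:
  assumes "n \<ge> 1" "m \<ge> 1" "w \<in> tuples n" "lp_op_norm p m n t \<le> 1"
  shows "N m (apply_matrix m n t w) \<le> N n w"
  using left[OF assms(1-3), of t] mult_right_mono[OF assms(4) N_nonneg[OF assms(1,3)]] by simp

text \<open>Axiom \<open>dual\<close> bounds one scalar pairing at a time. Pairing with a norming
  functional of the scalar tuple recovers its full l^p norm, and dividing \<open>f\<close> by
  \<open>C\<close> brings it into the dual unit ball.\<close>

lemma lp_norm_functional_le:
  assumes p: "1 \<le> p" and m: "m \<ge> 1" and w: "w \<in> tuples m"
    and f: "linear f" and fC: "\<And>x. \<bar>f x\<bar> \<le> C * norm x" and C: "C > 0"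
  shows "lp_norm p m (amplify f w) \<le> C * N m w"
proof -
  obtain b where b: "(\<Sum>i<m. b i * f (w i)) = lp_norm p m (amplify f w)"
      "\<And>x. \<bar>\<Sum>i<m. b i * x i\<bar> \<le> lp_norm p m x"
    by (rule lp_norming_functional[OF p m, of "amplify f w"]) (rule that, simp_all add: amplify_def)
  define b' where "b' i = (if i < m then b i else 0)" for i
  have b': "pairing m b' x = (\<Sum>i<m. b i * x i)" for x :: "nat \<Rightarrow> real"
    by (simp add: pairing_def b'_def)
  have "lp_dual_norm p m b' \<le> 1"
    unfolding lp_dual_norm_def
  proof (rule cSUP_least)
    show "lp_ball p m \<noteq> {}"
      using zero_tuples lp_norm_zero[OF p m] by (force simp: lp_ball_def)
  qed (use b(2) in \<open>force simp: lp_ball_def b' intro: order_trans\<close>)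
  moreover have bl: "bounded_linear (\<lambda>x. f x / C)"
  proof (rule bounded_linear_intro[of _ 1])
    show "norm (f x / C) \<le> norm x * 1" for x
      using fC[of x] C by (simp add: field_simps)
  qed (use f in \<open>auto simp: linear_add linear_scale add_divide_distrib\<close>)
  moreover have "norm (Blinfun (\<lambda>x. f x / C)) \<le> 1"
    by (rule norm_blinfun_bound) (use fC C bl in \<open>auto simp: bounded_linear_Blinfun_apply field_simps\<close>)
  moreover have "b' \<in> tuples m" by (simp add: tuples_def b'_def)
  ultimately have "\<bar>pairing m b' (amplify (\<lambda>x. f x / C) w)\<bar> \<le> N m w"
    using dual[OF m w, of b' "Blinfun (\<lambda>x. f x / C)"] by (simp add: bounded_linear_Blinfun_apply)
  moreover have "pairing m b' (amplify (\<lambda>x. f x / C) w) = lp_norm p m (amplify f w) / C"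
    using b(1) by (simp add: b') (simp add: amplify_def flip: sum_divide_distrib)
  ultimately show ?thesis using C by (simp add: field_simps)
qed

end

section \<open>Estimating amplifications of a finite-rank operator by the M-th one\<close>

context
  fixes p :: ereal
    and NX :: "nat \<Rightarrow> (nat \<Rightarrow> 'a::banach) \<Rightarrow> real"
    and NY :: "nat \<Rightarrow> (nat \<Rightarrow> 'b::banach) \<Rightarrow> real"
    and T :: "'a \<Rightarrow> 'b"
  assumes p: "1 \<le> p"
    and X: "multinormed p NX" and Y: "multinormed p NY"
    and T: "linear T"
begin

interpretation X: multinormed p NX by (rule X)
interpretation Y: multinormed p NY by (rule Y)

text \<open>Amplifications contain the operator itself: test on the elementary tensor with x / norm
  x in coordinate 0. Thus the operator norm, which governs the rounding error, is measured by the
  same \<open>A\<close>.\<close>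

lemma norm_le_amp_norm:
  assumes M: "M \<ge> 1" and A: "amp_norm NX NY M T = ennreal A" "0 \<le> A"
  shows "norm (T x) \<le> A * norm x"
proof (cases "x = 0")
  case True
  then show ?thesis by (simp add: linear_0[OF T])
next
  case False
  define a where "a i = (if i = 0 then 1 / norm x else 0 :: real)" for i :: nat
  have a: "a \<in> tuples M" using M by (simp add: a_def tuples_def)
  have norm_a: "lp_norm p M a = 1 / norm x"
    using lp_norm_single[OF p, of 0 M "1 / norm x"] M unfolding a_def by simp
  have "tensor a x \<in> {w \<in> tuples M. NX M w \<le> 1}"
    using X.cross[OF M a, of x] tensor_in_tuples[OF a] norm_a False by simp
  then have "ennreal (NY M (amplify T (tensor a x))) \<le> ennreal A"
    unfolding A(1)[symmetric] amp_norm_def by (rule SUP_upper)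
  then have "norm (T x) / norm x \<le> A"
    using A(2) Y.cross[OF M a, of "T x"] norm_a by (simp add: amplify_tensor[OF T])
  then show ?thesis using False by (simp add: field_simps)
qed

text \<open>Origin of the error 4 n^2 / K: the coordinate functionals contribute 2, the n summands
  of the weight \<open>l\<close> a factor n, the error and its projection a factor 2, and the n
  basis vectors another n.\<close>

lemma amplify_le_quantized:
  assumes n: "n \<ge> 1" "dim (range T) = n" and K: "K \<ge> 1" and M: "M = (2 * K) ^ n"
    and A: "amp_norm NX NY M T = ennreal A" "0 \<le> A"
    and m: "m \<ge> 1" and w: "w \<in> tuples m" and Nw: "NX m w \<le> 1"
  shows "NY m (amplify T w) \<le> A + 4 * real n ^ 2 / real K * A"
proof -
  have M1: "M \<ge> 1" using K M by simp
  note TA = norm_le_amp_norm[OF M1 A]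
  \<comment> \<open>\<open>lp_norm_functional_le\<close> divides by its constant, here
    \<open>2 * A\<close>; positive rank excludes T = 0.\<close>
  have "A \<noteq> 0"
  proof
    assume "A = 0"
    then have "range T \<subseteq> {0}" using TA by auto
    then have "dim (range T) = 0" using dim_le_card[of "range T" "{}"] by auto
    then show False using n by simp
  qed
  then have A0: "A > 0" using A(2) by simp
  have sub: "subspace (range T)" using T by (intro linear_subspace_image) auto
  obtain e \<phi> where e: "\<And>j. j < n \<Longrightarrow> norm (e j) \<le> 1"
    and \<phi>: "\<And>j. j < n \<Longrightarrow> linear (\<phi> j)"
      "\<And>j y. j < n \<Longrightarrow> y \<in> range T \<Longrightarrow> \<bar>\<phi> j y\<bar> \<le> 2 * norm y"
      "\<And>y. y \<in> range T \<Longrightarrow> y = (\<Sum>j<n. \<phi> j y *\<^sub>R e j)"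
    using that by (rule near_Auerbach_basis[OF sub n(2,1)])
  define F where "F j = amplify (\<lambda>x. \<phi> j (T x)) w" for j
  have lin: "linear (\<lambda>x. \<phi> j (T x))" if "j < n" for j
    using linear_compose[OF T \<phi>(1)[OF that]] by (simp add: o_def)
  have F_tuples: "F j \<in> tuples m" if "j < n" for j
    unfolding F_def by (rule amplify_in_tuples[OF lin[OF that] w])
  have F_norm: "lp_norm p m (F j) \<le> 2 * A" if "j < n" for j
  proof -
    have "\<bar>\<phi> j (T x)\<bar> \<le> 2 * A * norm x" for x
      using \<phi>(2)[OF that, of "T x"] TA[of x] by simp
    then have "lp_norm p m (F j) \<le> 2 * A * NX m w"
      unfolding F_def using A0 by (intro X.lp_norm_functional_le p m w lin[OF that]) auto
    also have "\<dots> \<le> 2 * A * 1" using Nw A0 by (intro mult_left_mono) auto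
    finally show ?thesis by simp
  qed
  \<comment> \<open>One weight for all j: it dominates every |F_j|, so all quotients lie in [-1, 1],
    and its norm is at most n times the bound for a single F_j.\<close>
  define l where "l i = (\<Sum>j<n. \<bar>F j i\<bar>)" for i
  have l: "\<bar>F j i\<bar> \<le> l i" if "j < n" for j i
    unfolding l_def using that by (intro member_le_sum) auto
  have l0: "0 \<le> l i" for i by (simp add: l_def sum_nonneg)
  have "lp_norm p m l \<le> (\<Sum>j<n. lp_norm p m (\<lambda>i. \<bar>F j i\<bar>))"
    unfolding l_def by (rule lp_norm_sum_le[OF p m]) simp
  also have "\<dots> \<le> (\<Sum>j<n. 2 * A)"
    by (intro sum_mono) (use F_norm in \<open>simp add: lp_norm_abs[OF p]\<close>)
  finally have l_norm: "lp_norm p m l \<le> 2 * real n * A" by (simp add: mult_ac)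
  \<comment> \<open>Where \<open>l i = 0\<close>, every \<open>F j i\<close> vanishes and the
    quotient is 0 by convention.\<close>
  have ratio: "\<bar>F j i / l i\<bar> \<le> 1" if "j < n" for j i
    using l[OF that, of i] l0[of i] by (cases "l i = 0") (auto simp: divide_le_eq_1)
  obtain c g where c: "\<And>i. c i < M"
    and g: "\<And>j i. j < n \<Longrightarrow> \<bar>F j i / l i - g j (c i)\<bar> \<le> 1 / real K"
  proof (rule grid_quantization[of n "\<lambda>j i. F j i / l i", OF ratio K, folded M])
    fix c g
    assume "\<And>i. c i < M" "\<And>j i. j < n \<Longrightarrow> \<bar>F j i / l i - g j (c i)\<bar> \<le> 1 / real K"
    then show thesis by (rule that[of c g])
  qed
  define d where "d j i = F j i - l i * g j (c i)" for j i
  have d_le: "\<bar>d j i\<bar> \<le> \<bar>1 / real K * l i\<bar>" if "j < n" for j i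
  proof (cases "l i = 0")
    case True
    then show ?thesis using l[OF that, of i] by (simp add: d_def)
  next
    case False
    then have "d j i = l i * (F j i / l i - g j (c i))" by (simp add: d_def algebra_simps)
    then have "\<bar>d j i\<bar> = l i * \<bar>F j i / l i - g j (c i)\<bar>" using l0 by (simp add: abs_mult)
    also have "\<dots> \<le> l i * (1 / real K)" by (intro mult_left_mono g that l0)
    finally show ?thesis using l0[of i] by simp
  qed
  have l_tuples: "l i = 0" if "i \<ge> m" for i
    using F_tuples that by (simp add: l_def tuples_def)
  have d_tuples: "d j \<in> tuples m" if "j < n" for j
    using F_tuples[OF that] l_tuples by (simp add: tuples_def d_def)
  have d_norm: "lp_norm p m (d j) \<le> 2 * real n * A / real K" if "j < n" for j
  proof -
    have "lp_norm p m (d j) \<le> lp_norm p m (\<lambda>i. 1 / real K * l i)"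
      by (rule lp_norm_mono[OF p m d_le[OF that]])
    also have "\<dots> = lp_norm p m l / real K"
      using lp_norm_scale[OF p m, of "1 / real K" l] by simp
    finally show ?thesis
      using l_norm divide_right_mono[OF l_norm, of "real K"] by linarith
  qed
  obtain P V where P: "lp_op_norm p M m P \<le> 1" and V: "lp_op_norm p m M V \<le> 1"
    and VP: "\<And>h i. i < m \<Longrightarrow>
      apply_matrix m M V (apply_matrix M m P (\<lambda>i. l i * h (c i))) i = l i * h (c i)"
    using that by (rule block_factorization[OF p m c, of l])
  define R where "R v = apply_matrix m M V (apply_matrix M m P v)" for v :: "nat \<Rightarrow> 'b"
  define \<delta> where "\<delta> j = tensor (d j) (e j)" for j
  have \<delta>_tuples: "\<delta> j \<in> tuples m" if "j < n" for j
    unfolding \<delta>_def by (rule tensor_in_tuples[OF d_tuples[OF that]])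
  have N_R: "NY m (R v) \<le> NY m v" if "v \<in> tuples m" for v
    unfolding R_def
    by (rule order_trans[OF Y.N_contraction[OF M1 m apply_matrix_in_tuples V]
          Y.N_contraction[OF m M1 that P]])
  have R_diff: "R (\<lambda>i. v i - u i) = (\<lambda>i. R v i - R u i)" for u v
    by (simp add: R_def apply_matrix_diff)
  have R_sum: "R (\<lambda>i. \<Sum>j<n. v j i) = (\<lambda>i. \<Sum>j<n. R (v j) i)" for v
    by (simp add: R_def apply_matrix_sum)
  \<comment> \<open>With the errors removed, the coefficient of each \<open>e j\<close> is
    \<open>l\<close> times a function of the cell number, which is the form preserved by
    \<open>VP\<close>.\<close>
  have R_fix: "R (\<lambda>i. amplify T w i - (\<Sum>j<n. \<delta> j i)) = (\<lambda>i. amplify T w i - (\<Sum>j<n. \<delta> j i))"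
  proof -
    have "amplify T w i = (\<Sum>j<n. F j i *\<^sub>R e j)" for i
      using \<phi>(3)[of "T (w i)"] by (simp add: F_def amplify_def)
    then have eq: "(\<lambda>i. amplify T w i - (\<Sum>j<n. \<delta> j i))
        = (\<lambda>i. \<Sum>j<n. tensor (\<lambda>i. l i * g j (c i)) (e j) i)"
      by (simp add: \<delta>_def tensor_def d_def flip: sum_subtractf scaleR_diff_left)
    have "R (tensor (\<lambda>i. l i * g j (c i)) (e j)) = tensor (\<lambda>i. l i * g j (c i)) (e j)" for j
    proof -
      have "apply_matrix m M V (apply_matrix M m P (\<lambda>i. l i * g j (c i))) = (\<lambda>i. l i * g j (c i))"
      proof
        fix i
        show "apply_matrix m M V (apply_matrix M m P (\<lambda>i. l i * g j (c i))) i = l i * g j (c i)"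
          using VP[of i "g j"] l_tuples[of i] by (cases "i < m") (auto simp: apply_matrix_def)
      qed
      then show ?thesis by (simp add: R_def apply_matrix_tensor)
    qed
    then show ?thesis unfolding eq R_sum by simp
  qed
  \<comment> \<open>\<open>R_fix\<close> solved for T w: only the error is compared with its image
    under \<open>R\<close>.\<close>
  have split: "amplify T w
      = (\<lambda>i. R (amplify T w) i + (\<Sum>j<n. \<delta> j i - R (\<delta> j) i))"
  proof
    fix i
    from fun_cong[OF R_fix, of i]
    show "amplify T w i = R (amplify T w) i + (\<Sum>j<n. \<delta> j i - R (\<delta> j) i)"
      unfolding R_diff R_sum by (simp add: sum_subtractf algebra_simps)
  qed
  have "NY m (R (amplify T w)) \<le> A"
  proof -
    \<comment> \<open>Here the scalar matrices are moved past T, so that T acts on a tuple of length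
      M in the unit ball.\<close>
    define z where "z = apply_matrix M m P w"
    have z: "z \<in> tuples M" "NX M z \<le> 1"
      using X.N_contraction[OF m M1 w P] Nw by (auto simp: z_def apply_matrix_in_tuples)
    have "R (amplify T w) = apply_matrix m M V (amplify T z)"
      by (simp add: R_def z_def amplify_apply_matrix[OF T])
    then have "NY m (R (amplify T w)) \<le> NY M (amplify T z)"
      using Y.N_contraction[OF M1 m amplify_in_tuples[OF T z(1)] V] by simp
    also have "ennreal (NY M (amplify T z)) \<le> ennreal A"
      unfolding A(1)[symmetric] amp_norm_def using z by (intro SUP_upper) simp
    then have "NY M (amplify T z) \<le> A" using A(2) by simp
    finally show ?thesis .
  qed
  moreover have "NY m (\<lambda>i. \<Sum>j<n. \<delta> j i - R (\<delta> j) i) \<le> 4 * real n ^ 2 / real K * A"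
  proof -
    have "NY m (\<lambda>i. \<delta> j i - R (\<delta> j) i) \<le> 4 * real n * A / real K" if "j < n" for j
    proof -
      have "NY m (\<lambda>i. \<delta> j i - R (\<delta> j) i) \<le> NY m (\<delta> j) + NY m (R (\<delta> j))"
        by (rule Y.N_triangle_diff[OF m \<delta>_tuples[OF that]]) (simp add: R_def apply_matrix_in_tuples)
      also have "\<dots> \<le> 2 * NY m (\<delta> j)" using N_R[OF \<delta>_tuples[OF that]] by simp
      also have "NY m (\<delta> j) = lp_norm p m (d j) * norm (e j)"
        unfolding \<delta>_def by (rule Y.cross[OF m d_tuples[OF that]])
      also have "\<dots> \<le> lp_norm p m (d j)"
        using e[OF that] lp_norm_nonneg[OF p m, of "d j"] by (simp add: mult_left_le)
      also note d_norm[OF that]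
      finally show ?thesis by simp
    qed
    then have "(\<Sum>j<n. NY m (\<lambda>i. \<delta> j i - R (\<delta> j) i)) \<le> (\<Sum>j<n. 4 * real n * A / real K)"
      by (intro sum_mono) simp
    moreover have "NY m (\<lambda>i. \<Sum>j<n. \<delta> j i - R (\<delta> j) i) \<le> (\<Sum>j<n. NY m (\<lambda>i. \<delta> j i - R (\<delta> j) i))"
      by (rule Y.N_sum_le[OF m])
        (use \<delta>_tuples in \<open>auto simp: tuples_def R_def apply_matrix_def\<close>)
    ultimately show ?thesis by (simp add: power2_eq_square mult_ac)
  qed
  moreover have "NY m (amplify T w)
      \<le> NY m (R (amplify T w)) + NY m (\<lambda>i. \<Sum>j<n. \<delta> j i - R (\<delta> j) i)"
    using \<delta>_tuples
    by (subst split, intro Y.N_triangle m) (auto simp: tuples_def R_def apply_matrix_def)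
  ultimately show ?thesis by linarith
qed

end

section \<open>Choice of the grid size\<close>

theorem theorem2p1:
  fixes p :: ereal
    and NX :: "nat \<Rightarrow> (nat \<Rightarrow> 'a::banach) \<Rightarrow> real"
    and NY :: "nat \<Rightarrow> (nat \<Rightarrow> 'b::banach) \<Rightarrow> real"
    and T :: "'a \<Rightarrow> 'b"
    and n :: nat and M :: nat and \<epsilon> :: real
  assumes "1 \<le> p"
    and "multinormed p NX" and "multinormed p NY"
    and "bounded_linear T"
    and "n \<ge> 1" and "dim (range T) = n"
    and "0 < \<epsilon>" and "\<epsilon> < 1"
    and "M = 2 ^ n * nat \<lceil>4 * real n ^ 3 / \<epsilon>\<rceil> ^ n"
  shows "multi_norm NX NY T \<le> ennreal (1 + \<epsilon>) * amp_norm NX NY M T"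
proof (cases "amp_norm NX NY M T")
  case (real A)
  define K where "K = nat \<lceil>4 * real n ^ 3 / \<epsilon>\<rceil>"
  have pos: "0 < 4 * real n ^ 3 / \<epsilon>" using assms by simp
  have K_ge: "4 * real n ^ 3 / \<epsilon> \<le> real K" unfolding K_def by linarith
  then have K: "K \<ge> 1" "real K > 0" using pos by linarith+
  \<comment> \<open>The error is quadratic in n while \<open>K\<close> is defined with a cube; n >=
    1 links the two.\<close>
  have "4 * real n ^ 2 \<le> 4 * real n ^ 3"
    using assms(5) by (intro mult_left_mono power_increasing) auto
  also have "\<dots> \<le> \<epsilon> * real K" using K_ge assms(7) by (simp add: field_simps)
  finally have err: "4 * real n ^ 2 / real K \<le> \<epsilon>" using K by (simp add: field_simps)
  have M: "M = (2 * K) ^ n" by (simp add: assms(9) K_def power_mult_distrib)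
  show ?thesis
    unfolding multi_norm_def amp_norm_def[of _ _ _ T for m]
  proof (intro SUP_least)
    fix m w assume m: "m \<in> {1::nat..}" and w: "w \<in> {w \<in> tuples m. NX m w \<le> 1}"
    have "NY m (amplify T w) \<le> A + 4 * real n ^ 2 / real K * A"
      using amplify_le_quantized[OF assms(1-3) bounded_linear.linear[OF assms(4)] assms(5,6) K(1) M,
          of A m w] real m w by auto
    also have "\<dots> \<le> (1 + \<epsilon>) * A"
      using mult_right_mono[OF err real(1)] by (simp add: algebra_simps)
    finally have "ennreal (NY m (amplify T w)) \<le> ennreal ((1 + \<epsilon>) * A)" by (rule ennreal_leI)
    then show "ennreal (NY m (amplify T w))
        \<le> ennreal (1 + \<epsilon>) * (SUP w\<in>{w \<in> tuples M. NX M w \<le> 1}. ennreal (NY M (amplify T w)))"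
      using real assms(7) by (simp add: ennreal_mult amp_norm_def)
  qed
next
  \<comment> \<open>An infinite M-th amplification norm makes the right side infinite, since 1 +
    \<epsilon> is positive.\<close>
  case top
  then show ?thesis using assms(7) by (simp add: ennreal_mult_top)
qed

end
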